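(* Let $\mathcal{H}$ be a complex Hilbert space, let $T$ be an $EP$ operator on $\mathcal{H}$ and let $A\in\mathcal{B}(\mathcal{H})$. If $AT=TA$ and $AT^\dagger T^*=T^\dagger T^*A$, then $AT^*=T^*A$.
   Context: $\mathcal{B}(\mathcal{H})$ is the space of bounded linear operators on $\mathcal{H}$; $\mathcal{R}(T)$ denotes the range of $T$ and $T^*$ its adjoint. For $T\in\mathcal{B}(\mathcal{H})$ with closed range, the Moore-Penrose inverse $T^\dagger$ is the unique operator in $\mathcal{B}(\mathcal{H})$ satisfying $TT^\dagger T=T$, $T^\dagger TT^\dagger=T^\dagger$, $TT^\dagger=(TT^\dagger)^*$ and $T^\dagger T=(T^\dagger T)^*$. An $EP$ operator on $\mathcal{H}$ is a $T\in\mathcal{B}(\mathcal{H})$ with closed range such that $\mathcal{R}(T)=\mathcal{R}(T^* )$. *)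

theory Defs
  imports "HOL-Analysis.Analysis"
begin

text \<open>Complex Hilbert spaces. The distribution only provides real inner product spaces. The real
  normed structure inherited from \<^class>\<open>banach\<close> is tied to the complex one by the two assumptions
  \<open>scaleR_eq_scaleC\<close> and \<open>norm_eq_sqrt_cinner\<close>, so that completeness refers to the norm of the
  complex inner product, which is linear in its first argument.\<close>

class complex_hilbert = banach +
  fixes scaleC :: "complex \<Rightarrow> 'a \<Rightarrow> 'a"
    and cinner :: "'a \<Rightarrow> 'a \<Rightarrow> complex"
  assumes scaleC_add_right: "scaleC c (x + y) = scaleC c x + scaleC c y"
    and scaleC_add_left: "scaleC (c + d) x = scaleC c x + scaleC d x"
    and scaleC_scaleC: "scaleC c (scaleC d x) = scaleC (c * d) x"
    and scaleC_one: "scaleC 1 x = x"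
    and scaleR_eq_scaleC: "scaleR r x = scaleC (complex_of_real r) x"
    and cinner_commute: "cinner x y = cnj (cinner y x)"
    and cinner_add_left: "cinner (x + y) z = cinner x z + cinner y z"
    and cinner_scaleC_left: "cinner (scaleC c x) y = c * cinner x y"
    and cinner_self_nonneg: "0 \<le> Re (cinner x x)"
    and cinner_self_eq_zero_iff: "cinner x x = 0 \<longleftrightarrow> x = 0"
    and norm_eq_sqrt_cinner: "norm x = sqrt (Re (cinner x x))"

lemma vector_space_scaleC: "vector_space (scaleC :: complex \<Rightarrow> 'a::complex_hilbert \<Rightarrow> 'a)"
  by unfold_locales (simp_all add: scaleC_add_right scaleC_add_left scaleC_scaleC scaleC_one)

instantiation complex :: complex_hilbert
begin

definition scaleC_complex :: "complex \<Rightarrow> complex \<Rightarrow> complex"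
  where "scaleC_complex c x = c * x"

definition cinner_complex :: "complex \<Rightarrow> complex \<Rightarrow> complex"
  where "cinner_complex x y = x * cnj y"

instance
  by standard
    (auto simp: scaleC_complex_def cinner_complex_def algebra_simps scaleR_conv_of_real
      cmod_def power2_eq_square complex_eq_iff add_nonneg_eq_0_iff)

end

text \<open>The operators of \<open>\<B>(\<H>)\<close> are the functions satisfying the following predicate; the product
  of operators is composition.\<close>

definition bounded_operator :: "('h::complex_hilbert \<Rightarrow> 'h) \<Rightarrow> bool"
  where "bounded_operator T \<longleftrightarrow>
    Vector_Spaces.linear scaleC scaleC T \<and> (\<exists>K. \<forall>x. norm (T x) \<le> K * norm x)"

definition hilbert_adjoint :: "('h::complex_hilbert \<Rightarrow> 'h) \<Rightarrow> 'h \<Rightarrow> 'h"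
  where "hilbert_adjoint T =
    (THE S. bounded_operator S \<and> (\<forall>x y. cinner (T x) y = cinner x (S y)))"

definition is_moore_penrose_inverse ::
    "('h::complex_hilbert \<Rightarrow> 'h) \<Rightarrow> ('h \<Rightarrow> 'h) \<Rightarrow> bool"
  where "is_moore_penrose_inverse T X \<longleftrightarrow>
    bounded_operator X \<and>
    T \<circ> X \<circ> T = T \<and>
    X \<circ> T \<circ> X = X \<and>
    T \<circ> X = hilbert_adjoint (T \<circ> X) \<and>
    X \<circ> T = hilbert_adjoint (X \<circ> T)"

text \<open>Like \<^const>\<open>hilbert_adjoint\<close>, the following is a definite description: it is only meaningful
  for bounded operators, and here only for those with closed range.\<close>

definition moore_penrose_inverse :: "('h::complex_hilbert \<Rightarrow> 'h) \<Rightarrow> 'h \<Rightarrow> 'h"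
  where "moore_penrose_inverse T = (THE X. is_moore_penrose_inverse T X)"

definition EP_operator :: "('h::complex_hilbert \<Rightarrow> 'h) \<Rightarrow> bool"
  where "EP_operator T \<longleftrightarrow>
    bounded_operator T \<and> closed (range T) \<and> range T = range (hilbert_adjoint T)"

end

theory Submission
  imports Defs
begin

text \<open>
  Write \<open>X\<close> for the Moore-Penrose inverse of \<open>T\<close>. Since the range of \<open>T\<^sup>*\<close> lies in the range of
  \<open>T\<close>, every \<open>T\<^sup>* y\<close> has the form \<open>T z\<close>, so that \<open>T X T = T\<close> yields \<open>T X T\<^sup>* = T\<^sup>*\<close>. If \<open>A\<close>
  commutes with \<open>T\<close> and with \<open>X T\<^sup>*\<close>, then it also commutes with their product \<open>T X T\<^sup>* = T\<^sup>*\<close>.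

  The algebra is short; the work lies in the fact that the adjoint and the Moore-Penrose inverse,
  both given by definite descriptions, exist and are unique. The adjoint comes from the Riesz
  representation theorem, hence from orthogonal projection onto a closed subspace
  (\<open>exists_orthogonal_projection\<close>). For an EP operator with range \<open>M\<close>, the subspace \<open>M\<close> is also the
  range of \<open>T\<^sup>*\<close> and hence the orthogonal complement of the kernel of \<open>T\<close>, so \<open>T\<close> restricts to a
  bijection of \<open>M\<close>, and \<open>X\<close> is the orthogonal projection onto \<open>M\<close> followed by the inverse of that
  bijection. The inverse is bounded because the set of all \<open>x \<in> M\<close> with \<open>\<parallel>T x\<parallel> \<le> 1\<close> is weakly
  bounded: pairing \<open>x\<close> with \<open>T\<^sup>* w\<close> gives the inner product of \<open>T x\<close> and \<open>w\<close>, and the vectors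
  \<open>T\<^sup>* w\<close> exhaust \<open>M\<close>. The uniform boundedness principle, a consequence of Baire's theorem, turns
  this into boundedness in norm (\<open>EP_operator_bounded_below\<close>).
\<close>

section \<open>The inner product and bounded operators\<close>

interpretation complex_space: vector_space "scaleC :: complex \<Rightarrow> 'h::complex_hilbert \<Rightarrow> 'h"
  by (rule vector_space_scaleC)

lemma cinner_add_right: "cinner x (y + z) = cinner x y + cinner (x::'h::complex_hilbert) z"
  by (metis cinner_add_left cinner_commute complex_cnj_add)

lemma cinner_scaleC_right: "cinner x (scaleC c y) = cnj c * cinner (x::'h::complex_hilbert) y"
  by (metis cinner_scaleC_left cinner_commute complex_cnj_mult)

lemma cinner_self: "cinner x x = complex_of_real ((norm (x::'h::complex_hilbert))\<^sup>2)"
proof -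
  have "Im (cinner x x) = 0"
    using arg_cong[OF cinner_commute[of x x], of Im] by simp
  then show ?thesis
    by (simp add: complex_eq_iff norm_eq_sqrt_cinner cinner_self_nonneg)
qed

lemma norm_scaleC: "norm (scaleC c x) = cmod c * norm (x::'h::complex_hilbert)"
proof -
  have "complex_of_real ((norm (scaleC c x))\<^sup>2) = c * cnj c * cinner x x"
    unfolding cinner_self[symmetric] by (simp add: cinner_scaleC_left cinner_scaleC_right)
  also have "\<dots> = complex_of_real ((cmod c * norm x)\<^sup>2)"
    by (simp add: cinner_self complex_norm_square[symmetric] power_mult_distrib)
  finally have "(norm (scaleC c x))\<^sup>2 = (cmod c * norm x)\<^sup>2"
    using of_real_eq_iff by blast
  then show ?thesis
    by (simp add: power2_eq_iff_nonneg)
qed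

lemma norm_diff_square:
  "(norm (x - y))\<^sup>2 = (norm x)\<^sup>2 + (norm y)\<^sup>2 - 2 * Re (cinner (x::'h::complex_hilbert) y)"
proof -
  have "x = (x - y) + y" by simp
  then have "cinner x x = cinner (x - y) (x - y) + cinner (x - y) y + cinner y x"
    by (metis cinner_add_left cinner_add_right add.assoc)
  moreover have "cinner x y = cinner (x - y) y + cinner y y"
    by (metis cinner_add_left diff_add_cancel)
  moreover have "Re (cinner y x) = Re (cinner x y)"
    using arg_cong[OF cinner_commute[of x y], of Re] by simp
  ultimately show ?thesis
    by (simp add: cinner_self complex_eq_iff)
qed

text \<open>Subtracting from \<open>x\<close> its component along \<open>y\<close> leaves a vector whose squared norm is
  \<open>\<parallel>x\<parallel>\<^sup>2 - \<bar>\<langle>x, y\<rangle>\<bar>\<^sup>2 / \<parallel>y\<parallel>\<^sup>2\<close>. This gives both the Cauchy-Schwarz inequality and the orthogonality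
  of the residual in a best approximation.\<close>

lemma norm_minus_component_square:
  fixes x y :: "'h::complex_hilbert"
  assumes "y \<noteq> 0"
  shows "(norm (x - scaleC (cinner x y / complex_of_real ((norm y)\<^sup>2)) y))\<^sup>2 =
    (norm x)\<^sup>2 - (cmod (cinner x y))\<^sup>2 / (norm y)\<^sup>2"
proof -
  define c where "c = cinner x y / complex_of_real ((norm y)\<^sup>2)"
  have "cnj c * cinner x y = complex_of_real ((cmod (cinner x y))\<^sup>2 / (norm y)\<^sup>2)"
    unfolding c_def using complex_norm_square[of "cinner x y"]
    by (simp add: mult.commute)
  then have "Re (cinner x (scaleC c y)) = (cmod (cinner x y))\<^sup>2 / (norm y)\<^sup>2"
    by (simp only: cinner_scaleC_right Re_complex_of_real)
  moreover have "(norm (scaleC c y))\<^sup>2 = (cmod (cinner x y))\<^sup>2 / (norm y)\<^sup>2"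
    unfolding norm_scaleC c_def using assms
    by (simp add: norm_divide power2_eq_square field_simps norm_mult)
  ultimately show ?thesis
    unfolding c_def[symmetric] norm_diff_square by simp
qed

lemma norm_cinner_le: "cmod (cinner x y) \<le> norm x * norm (y::'h::complex_hilbert)"
proof (cases "y = 0")
  case False
  have "0 \<le> (norm x)\<^sup>2 - (cmod (cinner x y))\<^sup>2 / (norm y)\<^sup>2"
    unfolding norm_minus_component_square[OF False, symmetric] by simp
  then have "(cmod (cinner x y))\<^sup>2 \<le> (norm x * norm y)\<^sup>2"
    using False by (simp add: pos_divide_le_eq power_mult_distrib)
  then show ?thesis
    by (rule power2_le_imp_le) simp
next
  case True
  then show ?thesis using cinner_add_right[of x 0 0] by auto
qed

text \<open>Over the reals the inner product is bilinear, which gives its continuity and the rules for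
  differences and negation in both arguments.\<close>

lemma cinner_bounded_bilinear:
  "bounded_bilinear (cinner :: 'h::complex_hilbert \<Rightarrow> 'h \<Rightarrow> complex)"
proof
  fix x x' y y' :: 'h and r :: real
  show "cinner (x + x') y = cinner x y + cinner x' y" by (rule cinner_add_left)
  show "cinner x (y + y') = cinner x y + cinner x y'" by (rule cinner_add_right)
  show "cinner (r *\<^sub>R x) y = r *\<^sub>R cinner x y"
    by (simp add: scaleR_eq_scaleC[of r x] cinner_scaleC_left scaleR_conv_of_real)
  show "cinner x (r *\<^sub>R y) = r *\<^sub>R cinner x y"
    by (simp add: scaleR_eq_scaleC[of r y] cinner_scaleC_right scaleR_conv_of_real)
  have "norm (cinner u v) \<le> norm u * norm v * 1" for u v :: 'h
    using norm_cinner_le[of u v] by simp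
  then show "\<exists>K. \<forall>u v :: 'h. norm (cinner u v) \<le> norm u * norm v * K"
    by blast
qed

interpretation cinner: bounded_bilinear "cinner :: 'h::complex_hilbert \<Rightarrow> 'h \<Rightarrow> complex"
  by (rule cinner_bounded_bilinear)

lemma parallelogram_law:
  "(norm (x - y))\<^sup>2 + (norm (x + y))\<^sup>2 = 2 * (norm x)\<^sup>2 + 2 * (norm (y::'h::complex_hilbert))\<^sup>2"
  using norm_diff_square[of x y] norm_diff_square[of x "- y"] by (simp add: cinner.minus_right)

lemma cinner_eq_zeroD: "(\<And>y. cinner x y = 0) \<Longrightarrow> x = (0::'h::complex_hilbert)"
  using cinner_self_eq_zero_iff by blast

lemma cinner_right_eqD:
  assumes "\<And>x. cinner x y = cinner x (z::'h::complex_hilbert)"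
  shows "y = z"
  using assms[of "y - z"] cinner_self_eq_zero_iff[of "y - z"] by (simp add: cinner.diff_right)

lemma bounded_operatorI:
  fixes T :: "'h::complex_hilbert \<Rightarrow> 'h"
  assumes "\<And>x y. T (x + y) = T x + T y" "\<And>c x. T (scaleC c x) = scaleC c (T x)"
    and "\<And>x. norm (T x) \<le> K * norm x"
  shows "bounded_operator T"
  unfolding bounded_operator_def using assms
  by (auto simp: Vector_Spaces.linear_iff vector_space_scaleC)

lemma bounded_operator_scaleC:
  "bounded_operator T \<Longrightarrow> T (scaleC c x) = scaleC c (T x)"
  unfolding bounded_operator_def by (simp add: Vector_Spaces.linear_iff)

lemma bounded_operator_bounded_linear:
  fixes T :: "'h::complex_hilbert \<Rightarrow> 'h"
  assumes "bounded_operator T"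
  shows "bounded_linear T"
proof -
  obtain K where K: "\<And>x. norm (T x) \<le> K * norm x"
    using assms unfolding bounded_operator_def by blast
  show ?thesis
  proof (rule bounded_linear_intro)
    show "T (x + y) = T x + T y" for x y
      using assms unfolding bounded_operator_def by (simp add: Vector_Spaces.linear_iff)
    show "T (r *\<^sub>R x) = r *\<^sub>R T x" for r x
      by (simp add: scaleR_eq_scaleC bounded_operator_scaleC[OF assms])
    show "norm (T x) \<le> norm x * K" for x
      using K[of x] by (simp add: mult.commute)
  qed
qed

lemma bounded_operator_comp:
  fixes S T :: "'h::complex_hilbert \<Rightarrow> 'h"
  assumes "bounded_operator S" "bounded_operator T"
  shows "bounded_operator (S \<circ> T)"
proof -
  interpret ST: bounded_linear "\<lambda>x. S (T x)"
    by (rule bounded_linear_compose[OF assms[THEN bounded_operator_bounded_linear]])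
  obtain K where K: "\<And>x. norm (S (T x)) \<le> norm x * K" using ST.bounded by blast
  show ?thesis
    by (rule bounded_operatorI[where K = K])
      (use K in \<open>simp_all add: ST.add bounded_operator_scaleC assms mult.commute\<close>)
qed

lemma subspace_range_bounded_operator:
  "bounded_operator T \<Longrightarrow> complex_space.subspace (range T)"
  unfolding bounded_operator_def
  using module_hom.subspace_image[OF Vector_Spaces.linear.axioms(3) complex_space.subspace_UNIV]
  by blast

section \<open>Orthogonal projection\<close>

text \<open>A minimizing sequence is Cauchy by the parallelogram law, as the midpoint of two points of
  \<open>M\<close> is again in \<open>M\<close> and cannot be closer to \<open>x\<close> than the distance of \<open>M\<close>. At the limit \<open>p\<close>, a
  nonzero component of \<open>x - p\<close> along some \<open>m \<in> M\<close> could be removed to come closer still.\<close>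

lemma exists_orthogonal_decomposition:
  fixes M :: "'h::complex_hilbert set"
  assumes "closed M" and M: "complex_space.subspace M"
  shows "\<exists>p\<in>M. \<forall>m\<in>M. cinner (x - p) m = 0"
proof -
  define d where "d = infdist x M"
  have ne: "M \<noteq> {}" using complex_space.subspace_0[OF M] by blast
  have d0: "0 \<le> d" unfolding d_def by (rule infdist_nonneg)
  have dle: "d \<le> norm (x - m)" if "m \<in> M" for m
    using infdist_le[OF that, of x] by (simp add: d_def dist_norm)
  have "\<exists>m\<in>M. norm (x - m) < d + 1 / real (Suc n)" for n
  proof -
    have "(INF a\<in>M. dist x a) < d + 1 / real (Suc n)"
      unfolding d_def infdist_notempty[OF ne] by simp
    then show ?thesis
      using cInf_lessD[of "dist x ` M"] ne by (auto simp: dist_norm)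
  qed
  then obtain f where fM: "\<And>n. f n \<in> M" and f: "\<And>n. norm (x - f n) < d + 1 / real (Suc n)"
    by metis
  have lim: "(\<lambda>n. norm (x - f n)) \<longlonglongrightarrow> d"
  proof (rule real_tendsto_sandwich)
    show "\<forall>\<^sub>F n in sequentially. d \<le> norm (x - f n)"
      using dle fM by simp
    show "\<forall>\<^sub>F n in sequentially. norm (x - f n) \<le> d + 1 / real (Suc n)"
      by (rule always_eventually) (use f less_imp_le in blast)
    show "(\<lambda>n. d + 1 / real (Suc n)) \<longlonglongrightarrow> d"
      using tendsto_add[OF tendsto_const LIMSEQ_inverse_real_of_nat, of d]
      by (simp add: inverse_eq_divide)
  qed simp
  have par: "(norm (f i - f j))\<^sup>2 \<le> 2 * ((norm (x - f i))\<^sup>2 - d\<^sup>2) + 2 * ((norm (x - f j))\<^sup>2 - d\<^sup>2)"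
    for i j
  proof -
    let ?u = "x - f i" and ?v = "x - f j"
    let ?m = "scaleC (1/2) (f i + f j)"
    have mM: "?m \<in> M"
      by (intro complex_space.subspace_scale[OF M] complex_space.subspace_add[OF M] fM)
    have m2: "?u + ?v = 2 *\<^sub>R (x - ?m)"
    proof -
      have "?m = (1/2) *\<^sub>R (f i + f j)" by (simp add: scaleR_eq_scaleC)
      then show ?thesis by (simp add: scaleR_right_diff_distrib scaleR_2)
    qed
    have "(norm (?u - ?v))\<^sup>2 + (norm (?u + ?v))\<^sup>2 = 2 * (norm ?u)\<^sup>2 + 2 * (norm ?v)\<^sup>2"
      by (rule parallelogram_law)
    moreover have "4 * d\<^sup>2 \<le> (norm (?u + ?v))\<^sup>2"
      unfolding m2 using power_mono[OF dle[OF mM] d0, of 2] by (simp add: power_mult_distrib)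
    moreover have "norm (f i - f j) = norm (?u - ?v)"
      by (simp add: norm_minus_commute)
    ultimately show ?thesis by simp
  qed
  have "(\<lambda>n. (norm (x - f n))\<^sup>2 - d\<^sup>2) \<longlonglongrightarrow> d\<^sup>2 - d\<^sup>2"
    by (intro tendsto_intros lim)
  then have sq: "(\<lambda>n. (norm (x - f n))\<^sup>2 - d\<^sup>2) \<longlonglongrightarrow> 0" by simp
  have "Cauchy f"
  proof (rule CauchyI)
    fix e :: real assume e: "0 < e"
    have "\<forall>\<^sub>F n in sequentially. (norm (x - f n))\<^sup>2 - d\<^sup>2 < e\<^sup>2 / 4"
      using e by (intro order_tendstoD[OF sq]) simp
    then obtain N where N: "\<And>n. n \<ge> N \<Longrightarrow> (norm (x - f n))\<^sup>2 - d\<^sup>2 < e\<^sup>2 / 4"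
      unfolding eventually_sequentially by blast
    have "norm (f i - f j) < e" if "i \<ge> N" "j \<ge> N" for i j
    proof -
      have "(norm (f i - f j))\<^sup>2 < e\<^sup>2" using par[of i j] N[OF that(1)] N[OF that(2)] by simp
      then show ?thesis by (rule power2_less_imp_less) (use e in simp)
    qed
    then show "\<exists>N. \<forall>m\<ge>N. \<forall>n\<ge>N. norm (f m - f n) < e" by blast
  qed
  then obtain p where p: "f \<longlonglongrightarrow> p" using Cauchy_convergent convergentD by blast
  have pM: "p \<in> M" using closed_sequentially[OF \<open>closed M\<close>] fM p by blast
  have "(\<lambda>n. norm (x - f n)) \<longlonglongrightarrow> norm (x - p)" by (intro tendsto_intros p)
  then have dp: "norm (x - p) = d" using lim LIMSEQ_unique by blast
  have "cinner (x - p) m = 0" if m: "m \<in> M" for m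
  proof (cases "m = 0")
    case False
    let ?m = "scaleC (cinner (x - p) m / complex_of_real ((norm m)\<^sup>2)) m"
    have "p + ?m \<in> M"
      by (intro complex_space.subspace_scale[OF M] complex_space.subspace_add[OF M] pM m)
    then have "d \<le> norm (x - p - ?m)" using dle by (simp add: diff_diff_add)
    then have "d\<^sup>2 \<le> (norm (x - p - ?m))\<^sup>2" using d0 by (simp add: power_mono)
    then have "(cmod (cinner (x - p) m))\<^sup>2 / (norm m)\<^sup>2 \<le> 0"
      unfolding norm_minus_component_square[OF False] dp by simp
    then show ?thesis using False by (simp add: divide_le_0_iff)
  qed (simp add: cinner.zero_right)
  then show ?thesis using pM by blast
qed

lemma exists_orthogonal_projection:
  fixes M :: "'h::complex_hilbert set"
  assumes "closed M" and M: "complex_space.subspace M"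
  shows "\<exists>P. bounded_operator P \<and> range P \<subseteq> M \<and> (\<forall>x. \<forall>m\<in>M. cinner (x - P x) m = 0)"
proof -
  obtain P where PM: "\<And>x. P x \<in> M" and P: "\<And>x m. m \<in> M \<Longrightarrow> cinner (x - P x) m = 0"
    using exists_orthogonal_decomposition[OF assms] by metis
  have uniq: "q = P x" if q: "q \<in> M" "\<And>m. m \<in> M \<Longrightarrow> cinner (x - q) m = 0" for x q
  proof -
    let ?w = "P x - q"
    have w: "?w \<in> M" by (intro complex_space.subspace_diff[OF M] PM q)
    have "cinner ?w ?w = cinner (x - q) ?w - cinner (x - P x) ?w"
      by (simp add: cinner.diff_left)
    then have "cinner ?w ?w = 0" using P[OF w] q(2)[OF w] by simp
    then show ?thesis using cinner_self_eq_zero_iff[of ?w] by simp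
  qed
  have P': "cinner (P x) m = cinner x m" if "m \<in> M" for x m
    using P[OF that, of x] by (simp add: cinner.diff_left)
  have "bounded_operator P"
  proof (rule bounded_operatorI[where K = 1])
    fix x y :: 'h
    show "P (x + y) = P x + P y"
      by (intro uniq[symmetric] complex_space.subspace_add[OF M] PM)
        (simp add: cinner.diff_left cinner.add_left P')
  next
    fix c and x :: 'h
    show "P (scaleC c x) = scaleC c (P x)"
      by (intro uniq[symmetric] complex_space.subspace_scale[OF M] PM)
        (simp add: cinner.diff_left cinner_scaleC_left P')
  next
    fix x :: 'h
    have "cinner x (P x) = cinner (P x) (P x)"
      by (simp add: P' PM)
    then have "(norm (P x))\<^sup>2 \<le> norm x * norm (P x)"
      using norm_cinner_le[of x "P x"] by (simp add: cinner_self norm_power)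
    then show "norm (P x) \<le> 1 * norm x"
      by (cases "P x = 0") (simp_all add: power2_eq_square)
  qed
  then show ?thesis using PM P by blast
qed

section \<open>The adjoint\<close>

text \<open>If \<open>f\<close> does not vanish, its kernel has a nonzero orthogonal vector \<open>v\<close>. Every
  \<open>(f v) x - (f x) v\<close> lies in the kernel, and orthogonality to \<open>v\<close> expresses \<open>f x\<close> by \<open>\<langle>x, v\<rangle>\<close>.\<close>

theorem riesz_representation:
  fixes f :: "'h::complex_hilbert \<Rightarrow> complex"
  assumes "bounded_linear f" and fc: "\<And>c x. f (scaleC c x) = c * f x"
  shows "\<exists>z. \<forall>x. f x = cinner x z"
proof (cases "\<forall>x. f x = 0")
  case True
  then show ?thesis by (intro exI[of _ 0]) (simp add: cinner.zero_right)
next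
  case False
  then obtain u where u: "f u \<noteq> 0" by blast
  interpret f: bounded_linear f by fact
  let ?M = "{x. f x = 0}"
  have "closed ?M" by (intro closed_Collect_eq f.continuous_on continuous_on_id continuous_on_const)
  moreover have "complex_space.subspace ?M"
    by (rule complex_space.subspaceI) (simp_all add: f.zero f.add fc)
  ultimately obtain p where p: "f p = 0" and orth: "\<And>m. f m = 0 \<Longrightarrow> cinner (u - p) m = 0"
    using exists_orthogonal_decomposition[of ?M u] by blast
  define v where "v = u - p"
  have fv: "f v \<noteq> 0" using u p by (simp add: v_def f.diff)
  then have v: "v \<noteq> 0" using f.zero by metis
  have key: "f x * cinner v v = f v * cinner x v" for x
  proof -
    have "f (scaleC (f v) x - scaleC (f x) v) = 0"
      by (simp add: f.diff fc)
    then have "cinner v (scaleC (f v) x - scaleC (f x) v) = 0"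
      using orth by (simp add: v_def)
    then have "cinner (scaleC (f v) x - scaleC (f x) v) v = 0"
      using cinner_commute[of _ v] by (metis complex_cnj_zero)
    then show ?thesis by (simp add: cinner.diff_left cinner_scaleC_left)
  qed
  have "f x = cinner x (scaleC (cnj (f v / cinner v v)) v)" for x
    using key[of x] v by (simp add: cinner_scaleC_right cinner_self_eq_zero_iff field_simps)
  then show ?thesis by blast
qed

lemma exists_adjoint:
  fixes T :: "'h::complex_hilbert \<Rightarrow> 'h"
  assumes "bounded_operator T"
  shows "\<exists>S. bounded_operator S \<and> (\<forall>x y. cinner (T x) y = cinner x (S y))"
proof -
  have bl: "bounded_linear T" by (rule bounded_operator_bounded_linear[OF assms])
  have "\<exists>z. \<forall>x. cinner (T x) y = cinner x z" for y
    by (rule riesz_representation)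
      (simp_all add: bounded_linear_compose[OF cinner.bounded_linear_left bl]
        bounded_operator_scaleC[OF assms] cinner_scaleC_left)
  then obtain S where S: "\<And>x y. cinner (T x) y = cinner x (S y)" by metis
  obtain K where K: "\<And>x. norm (T x) \<le> norm x * K"
    using bounded_linear.bounded[OF bl] by blast
  have "bounded_operator S"
  proof (rule bounded_operatorI[where K = K])
    show "S (x + y) = S x + S y" for x y
      by (rule cinner_right_eqD) (simp add: S[symmetric] cinner.add_right)
    show "S (scaleC c x) = scaleC c (S x)" for c x
      by (rule cinner_right_eqD) (simp add: S[symmetric] cinner_scaleC_right)
    show "norm (S y) \<le> K * norm y" for y
    proof (cases "S y = 0")
      case True
      have "0 \<le> norm y * K" using order_trans[OF norm_ge_zero K[of y]] .
      then show ?thesis using True by (simp add: mult.commute)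
    next
      case False
      have "(norm (S y))\<^sup>2 = cmod (cinner (T (S y)) y)"
        unfolding S by (simp add: cinner_self norm_power)
      also have "\<dots> \<le> norm (T (S y)) * norm y" by (rule norm_cinner_le)
      also have "\<dots> \<le> norm (S y) * K * norm y" by (intro mult_right_mono K) simp
      finally show ?thesis using False by (simp add: power2_eq_square)
    qed
  qed
  then show ?thesis using S by blast
qed

lemma hilbert_adjoint_eqI:
  fixes S T :: "'h::complex_hilbert \<Rightarrow> 'h"
  assumes "bounded_operator S" "\<And>x y. cinner (T x) y = cinner x (S y)"
  shows "hilbert_adjoint T = S"
  unfolding hilbert_adjoint_def
proof (rule the_equality)
  fix S' :: "'h \<Rightarrow> 'h"
  assume S': "bounded_operator S' \<and> (\<forall>x y. cinner (T x) y = cinner x (S' y))"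
  show "S' = S"
  proof
    show "S' y = S y" for y
      by (rule cinner_right_eqD) (metis S' assms(2))
  qed
qed (use assms in blast)

lemma hilbert_adjoint:
  fixes T :: "'h::complex_hilbert \<Rightarrow> 'h"
  assumes "bounded_operator T"
  shows "cinner (T x) y = cinner x (hilbert_adjoint T y)"
  using exists_adjoint[OF assms] hilbert_adjoint_eqI by metis

section \<open>The Moore-Penrose inverse of an EP operator\<close>

text \<open>Taking adjoints in \<open>Q P = R\<close> gives \<open>P Q = R\<close>. For two Moore-Penrose inverses \<open>X\<close> and \<open>Y\<close>
  of \<open>T\<close>, this turns \<open>(T Y) (T X) = T X\<close> into \<open>(T X) (T Y) = T X\<close>, whose left-hand side is also
  \<open>T Y\<close>; likewise \<open>(Y T) (X T) = Y T\<close> yields \<open>X T = Y T\<close>.\<close>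

lemma self_adjoint_product_commute:
  fixes P Q :: "'h::complex_hilbert \<Rightarrow> 'h"
  assumes "bounded_operator P" "P = hilbert_adjoint P"
    and "bounded_operator Q" "Q = hilbert_adjoint Q"
    and "bounded_operator R" "R = hilbert_adjoint R"
    and "\<And>x. Q (P x) = R x"
  shows "P (Q x) = R x"
proof (rule cinner_right_eqD)
  fix y
  have "cinner y (P (Q x)) = cinner (P y) (Q x)" using hilbert_adjoint[OF assms(1)] assms(2) by simp
  also have "\<dots> = cinner (Q (P y)) x" using hilbert_adjoint[OF assms(3)] assms(4) by simp
  also have "\<dots> = cinner y (R x)" using hilbert_adjoint[OF assms(5)] assms(6,7) by simp
  finally show "cinner y (P (Q x)) = cinner y (R x)" .
qed

lemma moore_penrose_inverse_unique:
  fixes T X Y :: "'h::complex_hilbert \<Rightarrow> 'h"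
  assumes "bounded_operator T"
    and X: "is_moore_penrose_inverse T X" and Y: "is_moore_penrose_inverse T Y"
  shows "X = Y"
proof -
  note D = is_moore_penrose_inverse_def
  have bX: "bounded_operator X" and bY: "bounded_operator Y" using X Y by (auto simp: D)
  have TXT: "T (X (T x)) = T x" and XTX: "X (T (X x)) = X x" for x
    using X unfolding D by (metis comp_apply)+
  have TYT: "T (Y (T x)) = T x" and YTY: "Y (T (Y x)) = Y x" for x
    using Y unfolding D by (metis comp_apply)+
  have adj: "T \<circ> X = hilbert_adjoint (T \<circ> X)" "X \<circ> T = hilbert_adjoint (X \<circ> T)"
    "T \<circ> Y = hilbert_adjoint (T \<circ> Y)" "Y \<circ> T = hilbert_adjoint (Y \<circ> T)"
    using X Y by (auto simp: D)
  note bdd = bounded_operator_comp[OF assms(1) bX] bounded_operator_comp[OF bX assms(1)]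
    bounded_operator_comp[OF assms(1) bY] bounded_operator_comp[OF bY assms(1)]
  have TX: "T (X x) = T (Y x)" for x
    using self_adjoint_product_commute[OF bdd(1) adj(1) bdd(3) adj(3) bdd(1) adj(1), of x]
    by (simp add: TXT TYT)
  have XT: "X (T x) = Y (T x)" for x
    using self_adjoint_product_commute[OF bdd(2) adj(2) bdd(4) adj(4) bdd(4) adj(4), of x]
    by (simp add: TXT TYT)
  show ?thesis
  proof
    fix x
    have "X x = X (T (Y x))" by (simp add: XTX TX[symmetric])
    also have "\<dots> = Y x" by (simp add: XT YTY)
    finally show "X x = Y x" .
  qed
qed

text \<open>Baire's theorem applies to the closed sets of those \<open>z\<close> for which \<open>n\<close> is a bound: one of
  them contains a ball around some \<open>z\<close> of radius \<open>e\<close>, so \<open>\<bar>\<langle>x, y\<rangle>\<bar> \<le> 2 n\<close> whenever \<open>x \<in> S\<close> and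
  \<open>\<parallel>y\<parallel> \<le> e\<close>, in particular for \<open>y\<close> a multiple of \<open>x\<close>.\<close>

lemma weakly_bounded_imp_bounded:
  fixes S :: "'h::complex_hilbert set"
  assumes "\<And>z. \<exists>K. \<forall>x\<in>S. cmod (cinner x z) \<le> K"
  shows "bounded S"
proof -
  define F where "F n = {z::'h. \<forall>x\<in>S. cmod (cinner x z) \<le> real n}" for n
  have closed: "closed (F n)" for n
  proof -
    have "F n = (\<Inter>x\<in>S. {z. cmod (cinner x z) \<le> real n})" by (auto simp: F_def)
    moreover have "closed {z. cmod (cinner x z) \<le> real n}" for x :: 'h
      by (intro closed_Collect_le continuous_intros
          bounded_linear.continuous_on[OF cinner.bounded_linear_right])
    ultimately show ?thesis by auto
  qed
  have cover: "(\<Union>n. F n) = UNIV"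
  proof -
    have "\<exists>n. z \<in> F n" for z
    proof -
      obtain K where K: "\<forall>x\<in>S. cmod (cinner x z) \<le> K" using assms by blast
      obtain n where "K \<le> real n" using real_arch_simple by blast
      then show ?thesis using K unfolding F_def by (auto intro: order_trans)
    qed
    then show ?thesis by blast
  qed
  have "\<exists>n. interior (F n) \<noteq> {}"
  proof (rule ccontr)
    assume "\<not> ?thesis"
    then have "euclidean interior_of (\<Union>n. F n) = {}"
      using closed by (intro Baire_category_alt)
        (auto simp: completely_metrizable_space_euclidean)
    then show False using cover by simp
  qed
  then obtain n z where "z \<in> interior (F n)" by blast
  then obtain e where e: "e > 0" "cball z e \<subseteq> F n"
    unfolding mem_interior_cball by blast
  have "norm x \<le> 2 * real n / e" if x: "x \<in> S" for x
  proof (cases "x = 0")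
    case False
    define y where "y = (e / norm x) *\<^sub>R x"
    have "z + y \<in> cball z e" "z \<in> cball z e"
      using e(1) False by (simp_all add: y_def dist_norm)
    then have "z + y \<in> F n" "z \<in> F n"
      using e(2) by blast+
    then have "cmod (cinner x (z + y)) \<le> real n" "cmod (cinner x z) \<le> real n"
      using x by (simp_all add: F_def)
    moreover have "cinner x y = cinner x (z + y) - cinner x z"
      by (simp add: cinner.add_right)
    ultimately have "cmod (cinner x y) \<le> 2 * real n"
      using norm_triangle_ineq4[of "cinner x (z + y)" "cinner x z"] by simp
    moreover have "cmod (cinner x y) = e * norm x"
      using e(1) False
      by (simp add: y_def cinner.scaleR_right cinner_self norm_mult power2_eq_square)
    ultimately show ?thesis using e(1) by (simp add: field_simps)
  qed (use e in simp)
  then show ?thesis unfolding bounded_iff by blast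
qed

text \<open>For every bounded operator the kernel is the orthogonal complement of the range of the adjoint, which
  here coincides with the range of \<open>T\<close>.\<close>

lemma EP_operator_kernel_orthogonal:
  fixes T :: "'h::complex_hilbert \<Rightarrow> 'h"
  assumes "EP_operator T"
  shows "T v = 0 \<longleftrightarrow> (\<forall>m\<in>range T. cinner v m = 0)"
proof -
  have b: "bounded_operator T" and r: "range T = range (hilbert_adjoint T)"
    using assms by (auto simp: EP_operator_def)
  have "T v = 0 \<longleftrightarrow> (\<forall>w. cinner (T v) w = 0)"
    using cinner_eq_zeroD by (auto simp: cinner.zero_left)
  also have "\<dots> \<longleftrightarrow> (\<forall>m\<in>range (hilbert_adjoint T). cinner v m = 0)"
    by (simp add: hilbert_adjoint[OF b])
  finally show ?thesis using r by simp
qed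

text \<open>Normalizing \<open>T x\<close> reduces the claim to a norm bound for the \<open>x\<close> in the range with
  \<open>\<parallel>T x\<parallel> \<le> 1\<close>, and for such \<open>x\<close> it suffices to have a weak bound. The case \<open>T x = 0\<close>, where normalizing
  is impossible, is excluded for \<open>x \<noteq> 0\<close> since the kernel is orthogonal to the range.\<close>

lemma EP_operator_bounded_below:
  fixes T :: "'h::complex_hilbert \<Rightarrow> 'h"
  assumes "EP_operator T"
  shows "\<exists>K. \<forall>x\<in>range T. norm x \<le> K * norm (T x)"
proof -
  have b: "bounded_operator T" and cl: "closed (range T)"
    and r: "range T = range (hilbert_adjoint T)"
    using assms by (auto simp: EP_operator_def)
  interpret T: bounded_linear T by (rule bounded_operator_bounded_linear[OF b])
  note sub = subspace_range_bounded_operator[OF b]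
  define S where "S = {x \<in> range T. norm (T x) \<le> 1}"
  have "\<exists>K. \<forall>x\<in>S. cmod (cinner x z) \<le> K" for z
  proof -
    \<comment> \<open>Only the component of \<open>z\<close> in the range matters, and it has the form \<open>T\<^sup>* w\<close>.\<close>
    obtain p where p: "p \<in> range T" and orth: "\<And>m. m \<in> range T \<Longrightarrow> cinner (z - p) m = 0"
      using exists_orthogonal_decomposition[OF cl sub] by blast
    obtain w where w: "p = hilbert_adjoint T w" using p r by blast
    have "cmod (cinner x z) \<le> norm w" if "x \<in> S" for x
    proof -
      have x: "x \<in> range T" "norm (T x) \<le> 1" using that by (auto simp: S_def)
      have "cinner x (z - p) = 0" using orth[OF x(1)] cinner_commute by (metis complex_cnj_zero)
      then have "cinner x z = cinner (T x) w"
        by (simp add: cinner.diff_right w hilbert_adjoint[OF b])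
      also have "cmod \<dots> \<le> norm (T x) * norm w" by (rule norm_cinner_le)
      also have "\<dots> \<le> 1 * norm w" by (intro mult_right_mono x) simp
      finally show ?thesis by simp
    qed
    then show ?thesis by blast
  qed
  then have "bounded S" by (rule weakly_bounded_imp_bounded)
  then obtain K where K: "\<And>x. x \<in> S \<Longrightarrow> norm x \<le> K" unfolding bounded_iff by blast
  have "norm x \<le> K * norm (T x)" if x: "x \<in> range T" for x
  proof (cases "T x = 0")
    case True
    then have "cinner x x = 0" using EP_operator_kernel_orthogonal[OF assms] x by blast
    then show ?thesis using True cinner_self_eq_zero_iff[of x] by simp
  next
    case False
    let ?y = "(1 / norm (T x)) *\<^sub>R x"
    have "?y \<in> range T"
      unfolding scaleR_eq_scaleC by (rule complex_space.subspace_scale[OF sub x])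
    moreover have "norm (T ?y) = 1" using False by (simp add: T.scaleR)
    ultimately have "norm ?y \<le> K" by (intro K) (simp add: S_def)
    then show ?thesis using False by (simp add: field_simps)
  qed
  then show ?thesis by blast
qed

text \<open>With \<open>P\<close> the orthogonal projection onto the range, \<open>X y\<close> is the unique preimage of \<open>P y\<close> under
  \<open>T\<close> that lies in the range. Then \<open>T X\<close> and \<open>X T\<close> are both equal to \<open>P\<close>, which is self-adjoint.\<close>

lemma EP_operator_has_moore_penrose_inverse:
  fixes T :: "'h::complex_hilbert \<Rightarrow> 'h"
  assumes "EP_operator T"
  shows "\<exists>X. is_moore_penrose_inverse T X"
proof -
  have b: "bounded_operator T" and cl: "closed (range T)"
    using assms by (auto simp: EP_operator_def)
  interpret T: bounded_linear T by (rule bounded_operator_bounded_linear[OF b])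
  note sub = subspace_range_bounded_operator[OF b]
  obtain P where bP: "bounded_operator P" and PM: "\<And>x. P x \<in> range T"
    and orth: "\<And>x m. m \<in> range T \<Longrightarrow> cinner (x - P x) m = 0"
    using exists_orthogonal_projection[OF cl sub] by blast
  interpret P: bounded_linear P by (rule bounded_operator_bounded_linear[OF bP])
  have TP: "T (P x) = T x" for x
  proof -
    have "T (x - P x) = 0" using EP_operator_kernel_orthogonal[OF assms] orth by blast
    then show ?thesis by (simp add: T.diff)
  qed
  have P_id: "P m = m" if m: "m \<in> range T" for m
  proof -
    have "m - P m \<in> range T" by (intro complex_space.subspace_diff[OF sub] m PM)
    then have "cinner (m - P m) (m - P m) = 0" by (rule orth)
    then show ?thesis using cinner_self_eq_zero_iff[of "m - P m"] by simp
  qed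
  have P_adj: "hilbert_adjoint P = P"
  proof (rule hilbert_adjoint_eqI[OF bP])
    fix x y
    have "cinner x (P y) = cinner (P x) (P y)"
      using orth[OF PM[of y], of x] by (simp add: cinner.diff_left)
    moreover have "cinner y (P x) = cinner (P y) (P x)"
      using orth[OF PM[of x], of y] by (simp add: cinner.diff_left)
    ultimately show "cinner (P x) y = cinner x (P y)" by (metis cinner_commute)
  qed
  obtain K where K: "\<And>x. x \<in> range T \<Longrightarrow> norm x \<le> K * norm (T x)"
    using EP_operator_bounded_below[OF assms] by blast
  have inj: "x = y" if "x \<in> range T" "y \<in> range T" "T x = T y" for x y
    using K[OF complex_space.subspace_diff[OF sub that(1,2)]] that(3) by (simp add: T.diff)
  \<comment> \<open>If \<open>P y = T u\<close>, then \<open>P u\<close> is a preimage of \<open>P y\<close> inside the range.\<close>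
  have "\<exists>x\<in>range T. T x = P y" for y
    using PM[of y] TP PM by (metis rangeE)
  then obtain X where XM: "\<And>y. X y \<in> range T" and TX: "\<And>y. T (X y) = P y" by metis
  have XT: "X (T x) = P x" for x
    by (rule inj) (simp_all add: XM PM TX TP P_id)
  obtain L where L: "\<And>x. norm (P x) \<le> norm x * L" using P.bounded by blast
  have "bounded_operator X"
  proof (rule bounded_operatorI[where K = "\<bar>K\<bar> * L"])
    show "X (x + y) = X x + X y" for x y
      by (rule inj) (simp_all add: XM TX T.add P.add complex_space.subspace_add[OF sub])
    show "X (scaleC c x) = scaleC c (X x)" for c x
      by (rule inj) (simp_all add: XM TX complex_space.subspace_scale[OF sub]
          bounded_operator_scaleC[OF b] bounded_operator_scaleC[OF bP])
    show "norm (X x) \<le> \<bar>K\<bar> * L * norm x" for x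
    proof -
      have "norm (X x) \<le> K * norm (P x)" using K[OF XM[of x]] by (simp add: TX)
      also have "\<dots> \<le> \<bar>K\<bar> * norm (P x)" by (intro mult_right_mono) auto
      also have "\<dots> \<le> \<bar>K\<bar> * (norm x * L)" by (intro mult_left_mono L) simp
      finally show ?thesis by (simp add: mult_ac)
    qed
  qed
  moreover have "T \<circ> X = P" "X \<circ> T = P" using TX XT by auto
  moreover have "P \<circ> T = T" "P \<circ> X = X" using P_id XM by auto
  ultimately have "is_moore_penrose_inverse T X"
    unfolding is_moore_penrose_inverse_def by (simp add: P_adj)
  then show ?thesis by blast
qed

lemma is_moore_penrose_inverse_moore_penrose_inverse:
  fixes T :: "'h::complex_hilbert \<Rightarrow> 'h"
  assumes "EP_operator T"
  shows "is_moore_penrose_inverse T (moore_penrose_inverse T)"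
proof -
  have "bounded_operator T" using assms by (simp add: EP_operator_def)
  then have "\<exists>!X. is_moore_penrose_inverse T X"
    using EP_operator_has_moore_penrose_inverse[OF assms] moore_penrose_inverse_unique by blast
  then show ?thesis unfolding moore_penrose_inverse_def by (rule theI')
qed

section \<open>Commuting with the adjoint\<close>

theorem theorem3p6:
  fixes T A :: "'h::complex_hilbert \<Rightarrow> 'h"
  assumes "EP_operator T"
    and "bounded_operator A"
    and "A \<circ> T = T \<circ> A"
    and "A \<circ> moore_penrose_inverse T \<circ> hilbert_adjoint T =
      moore_penrose_inverse T \<circ> hilbert_adjoint T \<circ> A"
  shows "A \<circ> hilbert_adjoint T = hilbert_adjoint T \<circ> A"
proof
  fix y
  let ?X = "moore_penrose_inverse T" and ?T' = "hilbert_adjoint T"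
  have TXT: "T (?X (T z)) = T z" for z
    using is_moore_penrose_inverse_moore_penrose_inverse[OF assms(1)]
    unfolding is_moore_penrose_inverse_def by (metis comp_apply)
  have TXT': "T (?X (?T' z)) = ?T' z" for z
  proof -
    obtain u where "?T' z = T u" using assms(1) unfolding EP_operator_def by blast
    then show ?thesis by (simp add: TXT)
  qed
  have "A (?T' y) = A (T (?X (?T' y)))" by (simp add: TXT')
  also have "\<dots> = T (A (?X (?T' y)))" using fun_cong[OF assms(3)] by simp
  also have "\<dots> = T (?X (?T' (A y)))" using fun_cong[OF assms(4), of y] by simp
  also have "\<dots> = ?T' (A y)" by (rule TXT')
  finally show "(A \<circ> ?T') y = (?T' \<circ> A) y" by simp
qed

end
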